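(* Let $T$ be a finite set with $N=|T|\ge2$, put $p=\log N$, let $m$ be an integer, and let $A_t\subset[d]$ ($t\in T$) satisfy $|A_t|\le m$. For each $t\in T$ let $K_t\subset\mathbb R_+^d$ be a nonempty compact convex downward-closed set all of whose elements are supported on $A_t$. Suppose $u>0$ and $$\max\left\{h_{K_t}(\mathbf 1_{A_t\setminus A_s}),\ h_{K_s}(\mathbf 1_{A_s\setminus A_t})\right\}\ge u\qquad\text{for all } s\ne t\text{ in }T .$$ Then there is one probability law $\nu$ on the (finite) set of admissible encoders such that $$a_t:=\frac{u}{2p}\,\mathbb E_{E\sim\nu}\,\tau_t^E\in K_t\qquad\text{for every }t\in T,$$ and these vectors satisfy, for every $s\in T$, $$\sum_{t\in T}\exp\left(-\frac{2p}{u}\,a_t(A_t\setminus A_s)\right)\le B_m,\qquad B_m=(m+1)4^m .$$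
   Context: $[d]=\{1,\dots,d\}$; logarithms are natural; $\mathbf 1_D\in\mathbb R^d$ is the indicator vector of $D\subset[d]$; for $v\in\mathbb R_+^d$ and $D\subset[d]$, $v(D)=\sum_{i\in D}v_i$. For compact $K\subset\mathbb R_+^d$, $h_K(w)=\max_{v\in K}\langle w,v\rangle$. $K$ is downward closed if $0\le z\le v\in K$ (coordinatewise) implies $z\in K$. Encoders. Fix once and for all a linear ordering of $[d]$. An admissible encoder $E$ (for the family $(A_t)_{t\in T}$) is a complete family $(C_t)_{t\in T}$ of pairwise distinct sets with $C_t\subset A_t$ for all $t\in T$. Given $E$, associate to it vectors $\tau_t^E\in\mathbb R_+^d$, $t\in T$, as follows. Partition the labels by $k=|C_t|$, and let $N_k$ be the number of labels with $|C_t|=k$. For a label $t$ with $|C_t|=k$, write $C_t$ as a word $(i_1,\dots,i_k)$ listed in the fixed order. For $0\le j\le k$ let $n_j(t)$ be the number of labels $t'$ with $|C_{t'}|=k$ whose word has the same first $j$ coordinates as that of $t$ (so $n_0(t)=N_k$ and $n_k(t)=1$). Set $\tau^E_{i_j}(t)=\log\frac{n_{j-1}(t)}{n_j(t)}$ for $1\le j\le k$, and $\tau^E_i(t)=0$ for $i\notin C_t$; then $\tau_t^E=(\tau_i^E(t))_{i\in[d]}$. *)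

theory Defs
  imports "HOL-Probability.Probability"
begin

text \<open>
  The ground set of coordinates is an arbitrary type of class \<open>{finite, linorder}\<close>; the class
  order is the linear ordering fixed once and for all. Vectors are elements of \<open>real ^ 'n\<close>, whose
  library order \<open>\<le>\<close> is the coordinatewise one. (The empty ground set, which is not a type, would
  contradict the separation hypothesis with \<open>u > 0\<close> and at least two labels.)
\<close>

definition indvec :: "'n::finite set \<Rightarrow> real ^ 'n" where
  "indvec D = (\<chi> i. indicator D i)"

definition mass :: "real ^ 'n::finite \<Rightarrow> 'n set \<Rightarrow> real" where
  "mass v D = (\<Sum>i\<in>D. v $ i)"

text \<open>For nonempty compact \<open>K\<close> the supremum is attained, i.e. it is the maximum.\<close>

definition support_fun :: "(real ^ 'n::finite) set \<Rightarrow> real ^ 'n \<Rightarrow> real" where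
  "support_fun K w = (SUP v\<in>K. w \<bullet> v)"

definition downward_closed :: "(real ^ 'n::finite) set \<Rightarrow> bool" where
  "downward_closed K \<longleftrightarrow> (\<forall>v\<in>K. \<forall>z. 0 \<le> z \<and> z \<le> v \<longrightarrow> z \<in> K)"

text \<open>
  An encoder is a family of sets indexed by \<open>T\<close>; \<open>PiE\<close> makes the family undefined outside \<open>T\<close>, so
  that two encoders are equal iff they agree on \<open>T\<close>, and there are finitely many of them.
\<close>

definition encoders :: "'t set \<Rightarrow> ('t \<Rightarrow> 'n set) \<Rightarrow> ('t \<Rightarrow> 'n set) set" where
  "encoders T A = {C \<in> (\<Pi>\<^sub>E t\<in>T. Pow (A t)). inj_on C T}"

definition code_word :: "('t \<Rightarrow> 'n::{finite,linorder} set) \<Rightarrow> 't \<Rightarrow> 'n list" where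
  "code_word C t = sorted_list_of_set (C t)"

definition prefix_count :: "'t set \<Rightarrow> ('t \<Rightarrow> 'n::{finite,linorder} set) \<Rightarrow> 't \<Rightarrow> nat \<Rightarrow> nat" where
  "prefix_count T C t j =
     card {t' \<in> T. card (C t') = card (C t) \<and> take j (code_word C t') = take j (code_word C t)}"

definition tau :: "'t set \<Rightarrow> ('t \<Rightarrow> 'n::{finite,linorder} set) \<Rightarrow> 't \<Rightarrow> real ^ 'n::{finite,linorder}" where
  "tau T C t = (\<chi> i.
     if i \<in> C t then
       let j = (THE j. 1 \<le> j \<and> j \<le> card (C t) \<and> code_word C t ! (j - 1) = i)
       in ln (real (prefix_count T C t (j - 1)) / real (prefix_count T C t j))
     else 0)"

text \<open>Isabelle lists are indexed from 0: the \<open>j\<close>-th letter of the word sits at index \<open>j - 1\<close>.\<close>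

lemma tau_nth_code_word:
  assumes "1 \<le> j" and "j \<le> card (C t)"
  shows "tau T C t $ (code_word C t ! (j - 1)) =
    ln (real (prefix_count T C t (j - 1)) / real (prefix_count T C t j))"
proof -
  let ?w = "code_word C t"
  have len: "length ?w = card (C t)" and dist: "distinct ?w" and set: "set ?w = C t"
    by (simp_all add: code_word_def)
  have "(THE j'. 1 \<le> j' \<and> j' \<le> card (C t) \<and> ?w ! (j' - 1) = ?w ! (j - 1)) = j"
  proof (rule the_equality)
    fix j' assume "1 \<le> j' \<and> j' \<le> card (C t) \<and> ?w ! (j' - 1) = ?w ! (j - 1)"
    then have "j' - 1 = j - 1" "1 \<le> j'"
      using assms len nth_eq_iff_index_eq[OF dist, of "j' - 1" "j - 1"] by auto
    then show "j' = j" using assms by linarith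
  qed (use assms in simp)
  moreover have "?w ! (j - 1) \<in> C t"
    using assms len set nth_mem[of "j - 1" ?w] by auto
  ultimately show ?thesis by (simp add: tau_def)
qed

lemma tau_outside: "i \<notin> C t \<Longrightarrow> tau T C t $ i = 0"
  by (simp add: tau_def)

end

theory Submission
  imports Defs
begin

text \<open>
  The law comes from a minimax argument. Below, \<open>E t\<close> stands for \<open>tau T E t\<close>.

  Given weights \<open>w t \<ge> 0\<close>, let \<open>M t\<close> be the maximum of \<open>w t \<bullet> v\<close> over \<open>v \<in> K t\<close>, and put into the
  code of \<open>t\<close> precisely the coordinates of \<open>A t\<close> whose weight is at most \<open>M t / u\<close>. If the support
  function of \<open>K t\<close> at the indicator of \<open>A t - A s\<close> is at least \<open>u\<close>, then some coordinate of
  \<open>A t - A s\<close> is that light, for otherwise a vector of \<open>K t\<close> with mass at least \<open>u\<close> on \<open>A t - A s\<close> would pair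
  with \<open>w t\<close> to more than \<open>M t\<close>. So the code of one of \<open>s\<close>, \<open>t\<close> leaves the set of the other, and
  the two codes differ. The total mass of \<open>E t\<close> telescopes to at most \<open>p = ln (card T)\<close>, whence
  \<open>w t \<bullet> E t \<le> M t * p / u\<close> (\<open>adapted_encoder\<close>). Weights of arbitrary sign reduce to nonnegative
  ones since \<open>K t\<close> is downward closed. As such an encoder exists for every family of weights, no
  hyperplane separates the convex hull of the finitely many points \<open>(u / (2 * p)) *\<^sub>R E\<close> from the
  product of the \<open>K t\<close>, so some average of encoders lies in that product (\<open>expectation_in_product\<close>).

  The bound on the sum holds for each single encoder (\<open>sum_exp_mass_tau_le\<close>) and passes to the
  average because \<open>exp\<close> is convex. For one encoder, the term of \<open>t\<close> is a product over the
  letters of its code word lying outside \<open>B = A s\<close>; the factor of a letter is the fraction of the words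
  with the current prefix that continue with it. Fractions of competing continuations add up to
  one, so letters outside \<open>B\<close> cost nothing in the sum, and only the choice of
  which positions carry letters of \<open>B\<close>, and of which letters these are, has to be counted: at most
  \<open>2 ^ m * 2 ^ m\<close> possibilities for each of the \<open>m + 1\<close> word lengths, as words are increasing.
\<close>

section \<open>Counting words by their prefixes\<close>

definition prefix_mult :: "'a list set \<Rightarrow> 'a list \<Rightarrow> nat \<Rightarrow> nat" where
  "prefix_mult W w j = card {v \<in> W. take j v = take j w}"

text \<open>
  The exponential of minus the mass that \<open>tau\<close> puts outside \<open>B\<close>, for a label whose code word is
  \<open>w\<close> and whose class of labels with equally many coordinates has the words \<open>W\<close>
  (see \<open>exp_mass_tau\<close>). Consider the descent in the tree of prefixes that enters a
  subtree with probability proportional to its number of words: this is the probability that it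
  follows \<open>w\<close>, except that the steps to letters of \<open>B\<close> are not charged.
\<close>

definition off_weight :: "'a set \<Rightarrow> 'a list set \<Rightarrow> 'a list \<Rightarrow> real" where
  "off_weight B W w = (\<Prod>j<length w. if w ! j \<in> B then 1
     else real (prefix_mult W w (Suc j)) / real (prefix_mult W w j))"

definition tails :: "'a \<Rightarrow> 'a list set \<Rightarrow> 'a list set" where
  "tails i W = {v. i # v \<in> W}"

lemma finite_tails: "finite W \<Longrightarrow> finite (tails i W)"
  using finite_vimageI[of W "(#) i"] by (simp add: tails_def vimage_def)

lemma prefix_mult_Cons: "prefix_mult W (i # w) (Suc j) = prefix_mult (tails i W) w j"
proof -
  have "{v \<in> W. take (Suc j) v = take (Suc j) (i # w)} =
      (#) i ` {v \<in> tails i W. take j v = take j w}"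
  proof (intro set_eqI iffI)
    fix v assume "v \<in> {v \<in> W. take (Suc j) v = take (Suc j) (i # w)}"
    then show "v \<in> (#) i ` {v \<in> tails i W. take j v = take j w}"
      by (cases v) (auto simp: tails_def)
  qed (auto simp: tails_def)
  then show ?thesis
    by (simp add: prefix_mult_def card_image)
qed

lemma off_weight_Nil: "off_weight B W [] = 1"
  by (simp add: off_weight_def)

text \<open>
  This recursion along the tree of prefixes allows an induction on the word length that passes
  from \<open>W\<close> to the subtrees below the first letters.
\<close>

lemma off_weight_Cons:
  "off_weight B W (i # w) =
    (if i \<in> B then 1 else real (card (tails i W)) / real (card W)) * off_weight B (tails i W) w"
proof -
  have 0: "prefix_mult V v 0 = card V" for V :: "'a list set" and v
    by (simp add: prefix_mult_def)
  show ?thesis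
    unfolding off_weight_def length_Cons prod.lessThan_Suc_shift
    by (simp add: prefix_mult_Cons 0 cong: if_cong)
qed

lemma off_weight_cong:
  assumes "\<And>i. i \<in> set w \<Longrightarrow> i \<in> B \<longleftrightarrow> i \<in> B'"
  shows "off_weight B W w = off_weight B' W w"
  unfolding off_weight_def by (rule prod.cong) (use assms in auto)

lemma sum_over_heads:
  fixes f :: "'a list \<Rightarrow> 'b::comm_monoid_add"
  assumes "finite W" and "[] \<notin> W"
  shows "(\<Sum>w\<in>W. f w) = (\<Sum>i\<in>hd ` W. \<Sum>v\<in>tails i W. f (i # v))"
proof -
  have "(\<Sum>i\<in>hd ` W. \<Sum>v\<in>tails i W. f (i # v)) =
      (\<Sum>(i, v)\<in>(SIGMA i:hd ` W. tails i W). f (i # v))"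
    by (rule sum.Sigma) (use assms finite_tails in auto)
  also have "\<dots> = (\<Sum>w\<in>W. f w)"
  proof (rule sum.reindex_bij_witness[of _ "\<lambda>w. (hd w, tl w)" "\<lambda>(i, v). i # v"])
    fix w assume w: "w \<in> W"
    then have "w \<noteq> []" using assms(2) by auto
    then show "(hd w, tl w) \<in> (SIGMA i:hd ` W. tails i W)"
      and "(case (hd w, tl w) of (i, v) \<Rightarrow> i # v) = w"
      using w by (auto simp: tails_def)
  qed (auto simp: tails_def)
  finally show ?thesis by simp
qed

text \<open>
  A nonempty subset of \<open>B\<close> is determined by its least element \<open>i\<close> and a set of elements above
  \<open>i\<close>; both sides count the nonempty subsets.
\<close>

lemma sum_two_power_card_above:
  fixes B :: "'a::linorder set"
  assumes "finite B"
  shows "(\<Sum>i\<in>B. (2::real) ^ card {b \<in> B. i < b}) = 2 ^ card B - 1"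
  using assms
proof (induction B rule: finite_linorder_min_induct)
  case (insert b B)
  have nb: "b \<notin> B" using insert.hyps by auto
  have b: "{x \<in> insert b B. b < x} = B" using insert.hyps by auto
  have "{x \<in> insert b B. i < x} = {x \<in> B. i < x}" if "i \<in> B" for i
    using insert.hyps(2) that by auto
  then have "(\<Sum>i\<in>B. (2::real) ^ card {x \<in> insert b B. i < x}) = (\<Sum>i\<in>B. 2 ^ card {x \<in> B. i < x})"
    by (intro sum.cong refl) simp
  then show ?case
    using nb insert.hyps(1) insert.IH by (subst sum.insert) (simp_all only: b card_insert_disjoint, simp_all)
qed simp

text \<open>
  Split by the first letter \<open>i\<close>. The letters outside \<open>B\<close> contribute an average over subtrees. After a
  letter \<open>i \<in> B\<close>, which is not charged, an increasing word meets only the elements of \<open>B\<close> above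
  \<open>i\<close>, and these contributions sum up by the previous lemma. Each of the two parts is at most half of
  the bound.
\<close>

lemma sum_off_weight_le:
  fixes B :: "'a::linorder set"
  assumes "finite B" and "finite W" and "\<And>w. w \<in> W \<Longrightarrow> length w = k \<and> sorted_wrt (<) w"
  shows "(\<Sum>w\<in>W. off_weight B W w) \<le> 2 ^ k * 2 ^ card B"
  using assms
proof (induction k arbitrary: W B)
  case 0
  then have "W \<subseteq> {[]}" by auto
  then have "(\<Sum>w\<in>W. off_weight B W w) \<le> 1"
    by (auto simp: subset_singleton_iff off_weight_Nil)
  also have "\<dots> \<le> 2 ^ card B" by simp
  finally show ?case by simp
next
  case (Suc k)
  let ?H = "hd ` W"
  let ?c = "\<lambda>i. real (card (tails i W)) / real (card W)"
  have ne: "[] \<notin> W" using Suc.prems(3) by fastforce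
  have finH: "finite ?H" using Suc.prems(2) by simp
  have IH: "(\<Sum>v\<in>tails i W. off_weight B (tails i W) v) \<le> 2 ^ k * 2 ^ card {b \<in> B. i < b}" for i
  proof -
    have tl: "length v = k \<and> sorted_wrt (<) v" and gt: "\<forall>b\<in>set v. i < b" if "v \<in> tails i W" for v
      using Suc.prems(3)[of "i # v"] that by (auto simp: tails_def)
    have "(\<Sum>v\<in>tails i W. off_weight B (tails i W) v) =
        (\<Sum>v\<in>tails i W. off_weight {b \<in> B. i < b} (tails i W) v)"
      by (intro sum.cong refl off_weight_cong) (use gt in auto)
    also have "\<dots> \<le> 2 ^ k * 2 ^ card {b \<in> B. i < b}"
      by (rule Suc.IH) (use Suc.prems(1,2) finite_tails tl in auto)
    finally show ?thesis .
  qed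
  have c: "(\<Sum>i\<in>?H. ?c i) \<le> 1"
  proof -
    have "card W = (\<Sum>i\<in>?H. card (tails i W))"
      using sum_over_heads[OF Suc.prems(2) ne, of "\<lambda>_. 1::nat"] by simp
    then have "(\<Sum>i\<in>?H. ?c i) = real (card W) / real (card W)"
      by (simp flip: sum_divide_distrib)
    then show ?thesis by simp
  qed
  have "(\<Sum>w\<in>W. off_weight B W w) =
      (\<Sum>i\<in>?H. (if i \<in> B then 1 else ?c i) * (\<Sum>v\<in>tails i W. off_weight B (tails i W) v))"
    by (simp add: sum_over_heads[OF Suc.prems(2) ne] off_weight_Cons sum_distrib_left)
  also have "\<dots> \<le> (\<Sum>i\<in>?H. (if i \<in> B then 1 else ?c i) * (2 ^ k * 2 ^ card {b \<in> B. i < b}))"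
    by (intro sum_mono mult_left_mono IH) auto
  \<comment> \<open>The second summand is an average over all of \<open>W\<close>; extending it to the letters of \<open>B\<close> is wasteful
    but makes its weights sum to one.\<close>
  also have "\<dots> \<le> (\<Sum>i\<in>?H. (if i \<in> B then 2 ^ k * 2 ^ card {b \<in> B. i < b} else 0)
                       + ?c i * (2 ^ k * 2 ^ card B))"
  proof (intro sum_mono)
    fix i
    have "(2::real) ^ card {b \<in> B. i < b} \<le> 2 ^ card B"
      using Suc.prems(1) by (intro power_increasing card_mono) auto
    then show "(if i \<in> B then 1 else ?c i) * (2 ^ k * 2 ^ card {b \<in> B. i < b})
        \<le> (if i \<in> B then 2 ^ k * 2 ^ card {b \<in> B. i < b} else 0) + ?c i * (2 ^ k * 2 ^ card B)"
      by (auto intro!: mult_left_mono divide_right_mono)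
  qed
  also have "\<dots> = (\<Sum>i\<in>?H \<inter> B. 2 ^ k * 2 ^ card {b \<in> B. i < b}) + (\<Sum>i\<in>?H. ?c i) * (2 ^ k * 2 ^ card B)"
    using finH by (simp add: sum.distrib sum.inter_restrict sum_distrib_right)
  also have "\<dots> \<le> (\<Sum>i\<in>B. 2 ^ k * 2 ^ card {b \<in> B. i < b}) + 1 * (2 ^ k * 2 ^ card B)"
    using Suc.prems(1) c by (intro add_mono sum_mono2 mult_right_mono) auto
  also have "\<dots> = 2 ^ k * (2 ^ card B - 1) + 2 ^ k * 2 ^ card B"
    using sum_two_power_card_above[OF Suc.prems(1)] by (simp flip: sum_distrib_left)
  also have "\<dots> \<le> 2 ^ Suc k * 2 ^ card B"
    by (simp add: algebra_simps)
  finally show ?case .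
qed

section \<open>The vectors of an encoder\<close>

lemma mass_tau:
  "mass (tau T C t) D = (\<Sum>j | j < card (C t) \<and> code_word C t ! j \<in> D.
     ln (real (prefix_count T C t j) / real (prefix_count T C t (Suc j))))"
proof -
  let ?w = "code_word C t"
  have w: "length ?w = card (C t)" "distinct ?w" "set ?w = C t"
    by (simp_all add: code_word_def)
  have nth: "bij_betw ((!) ?w) {..<card (C t)} (C t)"
    by (rule bij_betw_nth) (simp_all only: w)
  have bij: "bij_betw ((!) ?w) {j. j < card (C t) \<and> ?w ! j \<in> D} (D \<inter> C t)"
  proof (rule bij_betw_subset[OF nth])
    show "(!) ?w ` {j. j < card (C t) \<and> ?w ! j \<in> D} = D \<inter> C t"
      using bij_betw_imp_surj_on[OF nth] by fastforce
  qed auto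
  have "mass (tau T C t) D = (\<Sum>i\<in>D \<inter> C t. tau T C t $ i)"
    unfolding mass_def by (intro sum.mono_neutral_right) (auto simp: tau_outside)
  also have "\<dots> = (\<Sum>j | j < card (C t) \<and> ?w ! j \<in> D. tau T C t $ (?w ! j))"
    by (rule sum.reindex_bij_betw[OF bij, symmetric])
  also have "\<dots> = (\<Sum>j | j < card (C t) \<and> ?w ! j \<in> D.
      ln (real (prefix_count T C t j) / real (prefix_count T C t (Suc j))))"
    using tau_nth_code_word[of "Suc j" C t T for j] by (intro sum.cong) auto
  finally show ?thesis .
qed

lemma prefix_count_pos: "finite T \<Longrightarrow> t \<in> T \<Longrightarrow> 0 < prefix_count T C t j"
  by (auto simp: prefix_count_def card_gt_0_iff)

lemma prefix_count_Suc_le: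
  assumes "finite T"
  shows "prefix_count T C t (Suc j) \<le> prefix_count T C t j"
  unfolding prefix_count_def
proof (rule card_mono)
  have "take j v = take j w" if "take (Suc j) v = take (Suc j) w" for v w :: "'c list"
    using arg_cong[OF that, of "take j"] by simp
  then show "{t' \<in> T. card (C t') = card (C t) \<and>
        take (Suc j) (code_word C t') = take (Suc j) (code_word C t)}
      \<subseteq> {t' \<in> T. card (C t') = card (C t) \<and> take j (code_word C t') = take j (code_word C t)}"
    by blast
qed (use assms in simp)

lemma tau_nonneg:
  assumes "finite T" and "t \<in> T"
  shows "0 \<le> tau T C t $ i"
proof -
  have "tau T C t $ i = mass (tau T C t) {i}" by (simp add: mass_def)
  also have "0 \<le> \<dots>"
    unfolding mass_tau
    by (intro sum_nonneg ln_ge_zero)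
      (simp add: prefix_count_pos[OF assms] prefix_count_Suc_le[OF assms(1)])
  finally show ?thesis .
qed

text \<open>
  The logarithms telescope along the code word, from the number of labels in the class of \<open>t\<close>,
  at most \<open>card T\<close>, down to a count that is at least one because \<open>t\<close> counts itself.
\<close>

lemma sum_tau_le_ln_card:
  assumes "finite T" and "t \<in> T"
  shows "(\<Sum>i\<in>UNIV. tau T C t $ i) \<le> ln (real (card T))"
proof -
  let ?n = "\<lambda>j. real (prefix_count T C t j)"
  have pos: "0 < ?n j" for j using prefix_count_pos[OF assms] by simp
  have "(\<Sum>i\<in>UNIV. tau T C t $ i) = (\<Sum>j<card (C t). ln (?n j) - ln (?n (Suc j)))"
    using mass_tau[of T C t UNIV] pos prefix_count_pos[OF assms]
    by (simp add: mass_def lessThan_def ln_div)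
  also have "\<dots> = ln (?n 0) - ln (?n (card (C t)))"
    by (rule sum_lessThan_telescope')
  also have "\<dots> \<le> ln (?n 0)"
    using prefix_count_pos[OF assms, of C "card (C t)"] by (simp add: ln_ge_zero)
  also have "\<dots> \<le> ln (real (card T))"
    using pos[of 0] card_mono[OF assms(1), of "{t' \<in> T. card (C t') = card (C t)}"]
    by (intro ln_mono) (auto simp: prefix_count_def)
  finally show ?thesis .
qed

lemma code_word_inj:
  fixes C :: "'t \<Rightarrow> 'n::{finite,linorder} set"
  assumes "inj_on C S"
  shows "inj_on (code_word C) S"
proof (rule inj_onI)
  fix s t assume st: "s \<in> S" "t \<in> S" and eq: "code_word C s = code_word C t"
  have "set (code_word C r) = C r" for r by (simp add: code_word_def)
  then have "C s = C t" by (metis eq)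
  then show "s = t" using st by (rule inj_onD[OF assms])
qed

lemma exp_mass_tau:
  assumes "finite T" and "t \<in> T" and "inj_on C T" and "C t \<subseteq> D"
  shows "exp (- mass (tau T C t) (D - B)) =
    off_weight B (code_word C ` {t' \<in> T. card (C t') = card (C t)}) (code_word C t)"
proof -
  let ?w = "code_word C t" and ?k = "card (C t)" and ?n = "prefix_count T C t"
  let ?W = "code_word C ` {t' \<in> T. card (C t') = card (C t)}"
  have w: "length ?w = ?k" "set ?w = C t" by (simp_all add: code_word_def)
  have n: "prefix_mult ?W ?w j = ?n j" for j
  proof -
    have "{v \<in> ?W. take j v = take j ?w} =
        code_word C ` {t' \<in> T. card (C t') = card (C t) \<and> take j (code_word C t') = take j ?w}"
      by auto
    moreover have "inj_on (code_word C)
        {t' \<in> T. card (C t') = card (C t) \<and> take j (code_word C t') = take j ?w}"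
      by (rule code_word_inj) (auto intro: inj_on_subset[OF assms(3)])
    ultimately show ?thesis
      by (simp add: prefix_mult_def prefix_count_def card_image)
  qed
  have "{j. j < ?k \<and> ?w ! j \<in> D - B} = {j \<in> {..<?k}. ?w ! j \<notin> B}"
    using w assms(4) nth_mem[of _ ?w] by auto
  then have "exp (- mass (tau T C t) (D - B)) =
      (\<Prod>j\<in>{j \<in> {..<?k}. ?w ! j \<notin> B}. exp (- ln (real (?n j) / real (?n (Suc j)))))"
    by (simp add: mass_tau exp_sum flip: sum_negf)
  also have "\<dots> = (\<Prod>j\<in>{j \<in> {..<?k}. ?w ! j \<notin> B}. real (?n (Suc j)) / real (?n j))"
    by (intro prod.cong refl) (simp add: exp_minus prefix_count_pos[OF assms(1,2)])
  also have "\<dots> = off_weight B ?W ?w"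
    unfolding off_weight_def w(1) n
    by (subst prod.inter_filter) (auto intro!: prod.cong)
  finally show ?thesis .
qed

text \<open>
  Labels are grouped by the length \<open>k \<le> m\<close> of their words, which gives \<open>m + 1\<close> classes, and
  the bound on trees of increasing words applies to each class.
\<close>

lemma sum_exp_mass_tau_le:
  fixes A :: "'t \<Rightarrow> 'n::{finite,linorder} set"
  assumes "finite T" and "C \<in> encoders T A" and "\<And>t. t \<in> T \<Longrightarrow> card (A t) \<le> m" and "card B \<le> m"
  shows "(\<Sum>t\<in>T. exp (- mass (tau T C t) (A t - B))) \<le> (real m + 1) * 4 ^ m"
proof -
  have inj: "inj_on C T" and sub: "\<And>t. t \<in> T \<Longrightarrow> C t \<subseteq> A t"
    using assms(2) by (auto simp: encoders_def)
  let ?T = "\<lambda>k. {t \<in> T. card (C t) = k}"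
  have "card (C t) \<le> m" if "t \<in> T" for t
    using assms(3)[OF that] card_mono[OF _ sub[OF that]] by simp
  then have "(\<Sum>t\<in>T. exp (- mass (tau T C t) (A t - B))) =
      (\<Sum>k\<le>m. \<Sum>t\<in>?T k. exp (- mass (tau T C t) (A t - B)))"
    by (intro sum.group[symmetric]) (use assms(1) in auto)
  also have "\<dots> \<le> (\<Sum>k\<le>m. 4 ^ m)"
  proof (intro sum_mono)
    fix k assume k: "k \<in> {..m}"
    let ?W = "code_word C ` ?T k"
    have "(\<Sum>t\<in>?T k. exp (- mass (tau T C t) (A t - B))) =
        (\<Sum>t\<in>?T k. off_weight B ?W (code_word C t))"
      by (intro sum.cong refl) (use exp_mass_tau[OF assms(1) _ inj sub] in auto)
    also have "\<dots> = (\<Sum>w\<in>?W. off_weight B ?W w)"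
    proof (subst sum.reindex)
      show "inj_on (code_word C) (?T k)"
        by (rule code_word_inj) (auto intro: inj_on_subset[OF inj])
    qed simp
    also have "\<dots> \<le> 2 ^ k * 2 ^ card B"
      by (rule sum_off_weight_le) (use assms(1) in \<open>auto simp: code_word_def\<close>)
    also have "\<dots> \<le> 2 ^ m * 2 ^ m"
      using k assms(4) by (intro mult_mono power_increasing) auto
    also have "\<dots> = (4::real) ^ m"
      by (simp flip: power_mult_distrib)
    finally show "(\<Sum>t\<in>?T k. exp (- mass (tau T C t) (A t - B))) \<le> 4 ^ m" .
  qed
  also have "\<dots> = (real m + 1) * 4 ^ m" by simp
  finally show ?thesis .
qed

section \<open>An encoder adapted to given weights\<close>

text \<open>
  Some \<open>v \<in> K\<close> has mass at least \<open>u\<close> on \<open>D\<close>, so that \<open>w \<bullet> v\<close> is at least \<open>u\<close> times the smallest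
  weight on \<open>D\<close>.
\<close>

lemma light_coordinate:
  fixes w :: "real ^ 'n::finite"
  assumes "compact K" and "K \<noteq> {}" and "\<And>v. v \<in> K \<Longrightarrow> 0 \<le> v"
    and "0 < u" and "u \<le> support_fun K (indvec D)" and "0 \<le> w" and "\<And>v. v \<in> K \<Longrightarrow> w \<bullet> v \<le> M"
  shows "\<exists>i\<in>D. w $ i \<le> M / u"
proof -
  have "continuous_on K (\<lambda>v. indvec D \<bullet> v)" by (intro continuous_intros)
  then obtain v where v: "v \<in> K" and max: "\<And>y. y \<in> K \<Longrightarrow> indvec D \<bullet> y \<le> indvec D \<bullet> v"
    using continuous_attains_sup[OF assms(1,2)] by blast
  have "support_fun K (indvec D) \<le> indvec D \<bullet> v"
    unfolding support_fun_def using assms(2) max by (rule cSUP_least)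
  also have "\<dots> = (\<Sum>i\<in>D. v $ i)"
    by (simp add: inner_vec_def indvec_def indicator_def if_distrib[where f = "\<lambda>x. x * _"]
        flip: sum.inter_restrict cong: if_cong)
  finally have u: "u \<le> (\<Sum>i\<in>D. v $ i)" using assms(5) by simp
  then have D: "D \<noteq> {}" using assms(4) by auto
  have v0: "0 \<le> v $ i" and w0: "0 \<le> w $ i" for i
    using assms(3)[OF v] assms(6) by (simp_all add: less_eq_vec_def)
  define \<mu> where "\<mu> = Min ((\<lambda>i. w $ i) ` D)"
  have "\<mu> \<in> (\<lambda>i. w $ i) ` D" unfolding \<mu>_def using D by (intro Min_in) auto
  then obtain i where i: "i \<in> D" "w $ i = \<mu>" by auto
  have "w $ i * u \<le> w $ i * (\<Sum>i\<in>D. v $ i)" using u w0 by (rule mult_left_mono)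
  also have "\<dots> = (\<Sum>j\<in>D. \<mu> * v $ j)" using i by (simp add: sum_distrib_left)
  also have "\<dots> \<le> (\<Sum>j\<in>D. w $ j * v $ j)"
    using v0 by (intro sum_mono mult_right_mono) (auto simp: \<mu>_def)
  also have "\<dots> \<le> (\<Sum>j\<in>UNIV. w $ j * v $ j)"
    using v0 w0 by (intro sum_mono2) auto
  also have "\<dots> = w \<bullet> v" by (simp add: inner_vec_def)
  also have "\<dots> \<le> M" using v by (rule assms(7))
  finally have "w $ i \<le> M / u" using assms(4) by (simp add: le_divide_eq)
  then show ?thesis using i by blast
qed

text \<open>
  The best response of the encoder in the minimax argument. Only coordinates of weight at most
  \<open>M t / u\<close> are used, so the inequality is the threshold times the total mass of \<open>tau\<close>; the
  separation hypothesis makes this code injective.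
\<close>

lemma adapted_encoder:
  fixes A :: "'t \<Rightarrow> 'n::{finite,linorder} set" and w :: "'t \<Rightarrow> real ^ 'n::{finite,linorder}"
  assumes "finite T"
    and K: "\<And>t. t \<in> T \<Longrightarrow> K t \<noteq> {} \<and> compact (K t)"
    and K0: "\<And>t v. t \<in> T \<Longrightarrow> v \<in> K t \<Longrightarrow> 0 \<le> v"
    and u: "u > 0"
    and sep: "\<And>s t. s \<in> T \<Longrightarrow> t \<in> T \<Longrightarrow> s \<noteq> t \<Longrightarrow>
      max (support_fun (K t) (indvec (A t - A s))) (support_fun (K s) (indvec (A s - A t))) \<ge> u"
    and w0: "\<And>t. t \<in> T \<Longrightarrow> 0 \<le> w t"
    and M: "\<And>t v. t \<in> T \<Longrightarrow> v \<in> K t \<Longrightarrow> w t \<bullet> v \<le> M t"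
  shows "\<exists>C\<in>encoders T A. \<forall>t\<in>T. w t \<bullet> tau T C t \<le> M t / u * ln (real (card T))"
proof -
  define C where "C = (\<lambda>t\<in>T. {i \<in> A t. w t $ i \<le> M t / u})"
  have light: "\<exists>i\<in>A t - A s. i \<in> C t"
    if "t \<in> T" "u \<le> support_fun (K t) (indvec (A t - A s))" for s t
    using light_coordinate[of "K t" u "A t - A s" "w t" "M t"] K[OF that(1)] K0[OF that(1)]
      u that w0[OF that(1)] M[OF that(1)]
    by (auto simp: C_def)
  have sub: "C t \<subseteq> A t" if "t \<in> T" for t using that by (auto simp: C_def)
  have "inj_on C T"
  proof (rule inj_onI, rule ccontr)
    fix s t assume st: "s \<in> T" "t \<in> T" "C s = C t" "s \<noteq> t"
    consider "u \<le> support_fun (K t) (indvec (A t - A s))"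
      | "u \<le> support_fun (K s) (indvec (A s - A t))"
      using sep[OF st(1,2,4)] by linarith
    then show False
      by cases (use light[OF st(2)] light[OF st(1)] sub st in blast)+
  qed
  then have "C \<in> encoders T A"
    by (auto simp: encoders_def C_def)
  moreover have "w t \<bullet> tau T C t \<le> M t / u * ln (real (card T))" if t: "t \<in> T" for t
  proof -
    obtain v where v: "v \<in> K t" using K[OF t] by blast
    have "0 \<le> w t \<bullet> v"
      using w0[OF t] K0[OF t v]
      by (auto simp: inner_vec_def less_eq_vec_def intro!: sum_nonneg)
    then have M0: "0 \<le> M t / u" using M[OF t v] u by simp
    have "w t \<bullet> tau T C t = (\<Sum>i\<in>UNIV. w t $ i * tau T C t $ i)"
      by (simp add: inner_vec_def)
    also have "\<dots> \<le> (\<Sum>i\<in>UNIV. M t / u * tau T C t $ i)"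
    proof (intro sum_mono)
      fix i
      show "w t $ i * tau T C t $ i \<le> M t / u * tau T C t $ i"
      proof (cases "i \<in> C t")
        case True
        then show ?thesis
          using t tau_nonneg[OF assms(1) t] by (intro mult_right_mono) (auto simp: C_def)
      qed (simp add: tau_outside)
    qed
    also have "\<dots> = M t / u * (\<Sum>i\<in>UNIV. tau T C t $ i)"
      by (simp add: sum_distrib_left)
    also have "\<dots> \<le> M t / u * ln (real (card T))"
      using sum_tau_le_ln_card[OF assms(1) t] M0 by (rule mult_left_mono)
    finally show ?thesis .
  qed
  ultimately show ?thesis by blast
qed

section \<open>From best responses to one common law\<close>

lemma expectation_finite:
  fixes X :: "'e \<Rightarrow> 'a::euclidean_space"
  assumes "finite F" and "set_pmf \<nu> \<subseteq> F"
  shows "measure_pmf.expectation \<nu> X = (\<Sum>e\<in>F. pmf \<nu> e *\<^sub>R X e)"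
  using assms by (intro integral_measure_pmf) auto

lemma convex_combination_as_expectation:
  fixes X :: "'e \<Rightarrow> 'a::euclidean_space"
  assumes "finite F" and "y \<in> convex hull (X ` F)"
  shows "\<exists>\<nu>. set_pmf \<nu> \<subseteq> F \<and> measure_pmf.expectation \<nu> X = y"
proof -
  obtain c where c: "\<forall>x\<in>X ` F. 0 \<le> c x" "sum c (X ` F) = 1" "(\<Sum>x\<in>X ` F. c x *\<^sub>R x) = y"
    using assms by (auto simp: convex_hull_finite)
  \<comment> \<open>\<open>G\<close> picks one preimage of every point, as \<open>X\<close> need not be injective.\<close>
  define G where "G = inv_into F X ` X ` F"
  have inj: "inj_on (inv_into F X) (X ` F)" by (simp add: inj_on_inv_into)
  have G: "finite G" "G \<subseteq> F" using assms(1) by (auto simp: G_def inv_into_into)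
  define f where "f e = (if e \<in> G then c (X e) else 0)" for e
  have f_out: "f e = 0" if "e \<notin> G" for e using that by (simp add: f_def)
  have f0: "0 \<le> f e" for e using c(1) G by (auto simp: f_def)
  have sumG: "(\<Sum>e\<in>G. g (X e)) = (\<Sum>x\<in>X ` F. g x)" for g :: "'a \<Rightarrow> 'b::comm_monoid_add"
    unfolding G_def by (subst sum.reindex[OF inj]) (auto intro!: sum.cong simp: f_inv_into_f)
  have "(\<integral>\<^sup>+ e. ennreal (f e) \<partial>count_space UNIV) = (\<Sum>e\<in>G. ennreal (f e))"
    by (rule nn_integral_count_space'[OF G(1)]) (simp_all add: f_out)
  also have "\<dots> = ennreal (\<Sum>e\<in>G. c (X e))"
    using c(1) G(2) by (subst sum_ennreal[symmetric]) (auto simp: f_def)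
  finally have f1: "(\<integral>\<^sup>+ e. ennreal (f e) \<partial>count_space UNIV) = 1"
    using sumG[of c] c(2) by simp
  define \<nu> where "\<nu> = embed_pmf f"
  have \<nu>: "pmf \<nu> e = f e" for e unfolding \<nu>_def by (rule pmf_embed_pmf[OF f0 f1])
  have set: "set_pmf \<nu> \<subseteq> G" using f_out by (force simp: set_pmf_iff \<nu>)
  have "measure_pmf.expectation \<nu> X = (\<Sum>e\<in>G. c (X e) *\<^sub>R X e)"
    by (simp add: expectation_finite[OF G(1) set] \<nu> f_def)
  then show ?thesis using sumG[of "\<lambda>x. c x *\<^sub>R x"] c(3) set G(2) by auto
qed

text \<open>
  A law whose expectation lies in \<open>Q\<close> fails to exist only if a hyperplane separates \<open>Q\<close> from the
  polytope spanned by the points \<open>X e\<close>; its normal vector \<open>w\<close> then violates the hypothesis.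
\<close>

lemma expectation_in_convex:
  fixes X :: "'e \<Rightarrow> 'a::euclidean_space"
  assumes "finite F" and "closed Q" and "convex Q"
    and ineq: "\<And>w. \<exists>e\<in>F. \<exists>z\<in>Q. w \<bullet> X e \<le> w \<bullet> z"
  shows "\<exists>\<nu>. set_pmf \<nu> \<subseteq> F \<and> measure_pmf.expectation \<nu> X \<in> Q"
proof -
  have "F \<noteq> {}" using ineq by blast
  have "Q \<inter> convex hull (X ` F) \<noteq> {}"
  proof
    assume "Q \<inter> convex hull (X ` F) = {}"
    moreover have "compact (convex hull (X ` F))" "convex hull (X ` F) \<noteq> {}"
      using assms(1) \<open>F \<noteq> {}\<close> by (auto intro: finite_imp_compact_convex_hull)
    ultimately obtain w b where "\<forall>z\<in>Q. w \<bullet> z < b" "\<forall>x\<in>convex hull (X ` F). b < w \<bullet> x"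
      using separating_hyperplane_closed_compact[OF assms(3,2), of "convex hull (X ` F)"] by auto
    moreover have "X e \<in> convex hull (X ` F)" if "e \<in> F" for e using that by (simp add: hull_inc)
    ultimately show False using ineq[of w] by (meson less_trans not_less)
  qed
  then show ?thesis using convex_combination_as_expectation[OF assms(1)] by blast
qed

text \<open>
  The same law must serve all \<open>t \<in> T\<close>, so the separation takes place in a product of copies of the
  space \<open>'a\<close>. Separation needs a Euclidean space, that is, a finite index type, while \<open>T\<close> is a
  finite set in an arbitrary type: the injection \<open>f\<close> transports the index set into the finite type
  \<open>'i\<close>.
\<close>

lemma expectation_in_product:
  fixes X :: "'e \<Rightarrow> 't \<Rightarrow> 'a::euclidean_space" and f :: "'t \<Rightarrow> 'i::finite"
  assumes "finite F" and f: "inj_on f T"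
    and L: "\<And>t. t \<in> T \<Longrightarrow> closed (L t) \<and> convex (L t)"
    and ineq: "\<And>w. \<exists>e\<in>F. \<exists>z. (\<forall>t\<in>T. z t \<in> L t) \<and>
      (\<Sum>t\<in>T. w t \<bullet> X e t) \<le> (\<Sum>t\<in>T. w t \<bullet> z t)"
  shows "\<exists>\<nu>. set_pmf \<nu> \<subseteq> F \<and> (\<forall>t\<in>T. measure_pmf.expectation \<nu> (\<lambda>e. X e t) \<in> L t)"
proof -
  define emb :: "('t \<Rightarrow> 'a) \<Rightarrow> 'a ^ 'i" where
    "emb y = (\<chi> i. if i \<in> f ` T then y (inv_into T f i) else 0)" for y
  have emb: "emb y $ f t = y t" if "t \<in> T" for y t
    using that f by (simp add: emb_def)
  define Q where "Q = (\<Inter>t\<in>T. (\<lambda>z. z $ f t) -` L t)"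
  have "closed Q"
    unfolding Q_def using L by (intro closed_INT ballI closed_vimage) (auto intro: continuous_intros)
  moreover have "convex Q"
    unfolding Q_def using L
    by (intro convex_INT convex_linear_vimage) (auto intro: bounded_linear.linear bounded_linear_vec_nth)
  moreover have "\<exists>e\<in>F. \<exists>z\<in>Q. w \<bullet> emb (X e) \<le> w \<bullet> z" for w :: "'a ^ 'i"
  proof -
    have inner: "w \<bullet> emb y = (\<Sum>t\<in>T. w $ f t \<bullet> y t)" for y
    proof -
      have "w \<bullet> emb y = (\<Sum>i\<in>f ` T. w $ i \<bullet> emb y $ i)"
        unfolding inner_vec_def by (intro sum.mono_neutral_right) (auto simp: emb_def)
      then show ?thesis by (simp add: sum.reindex[OF f] emb)
    qed
    obtain e z where e: "e \<in> F" and z: "\<forall>t\<in>T. z t \<in> L t"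
      and le: "(\<Sum>t\<in>T. w $ f t \<bullet> X e t) \<le> (\<Sum>t\<in>T. w $ f t \<bullet> z t)"
      using ineq[of "\<lambda>t. w $ f t"] by (elim bexE exE conjE)
    have "w \<bullet> emb (X e) \<le> w \<bullet> emb z" using le by (simp only: inner)
    moreover have "emb z \<in> Q" using z by (simp add: Q_def emb)
    ultimately show ?thesis using e by blast
  qed
  ultimately obtain \<nu> where \<nu>: "set_pmf \<nu> \<subseteq> F"
    and Q: "measure_pmf.expectation \<nu> (\<lambda>e. emb (X e)) \<in> Q"
    using expectation_in_convex[OF assms(1), of Q "\<lambda>e. emb (X e)"] by blast
  have "measure_pmf.expectation \<nu> (\<lambda>e. X e t) = measure_pmf.expectation \<nu> (\<lambda>e. emb (X e)) $ f t"
    if "t \<in> T" for t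
    using that by (simp add: expectation_finite[OF assms(1) \<nu>] emb)
  then show ?thesis using \<nu> Q by (auto simp: Q_def)
qed

section \<open>Averaging the encoders\<close>

text \<open>
  Setting to zero the coordinates of a maximiser at which \<open>w\<close> is negative stays in the downward
  closed set \<open>K\<close>, and turns the pairing with the positive part of \<open>w\<close> into the pairing with \<open>w\<close>.
\<close>

lemma positive_part_attained:
  fixes K :: "(real ^ 'n::finite) set" and w :: "real ^ 'n"
  assumes "compact K" and "K \<noteq> {}" and "downward_closed K" and "\<And>v. v \<in> K \<Longrightarrow> 0 \<le> v"
  shows "\<exists>z\<in>K. \<forall>v\<in>K. (\<chi> i. max (w $ i) 0) \<bullet> v \<le> w \<bullet> z"
proof -
  let ?w = "(\<chi> i. max (w $ i) 0) :: real ^ 'n"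
  have "continuous_on K (\<lambda>v. ?w \<bullet> v)" by (intro continuous_intros)
  then obtain v where v: "v \<in> K" and max: "\<forall>y\<in>K. ?w \<bullet> y \<le> ?w \<bullet> v"
    using continuous_attains_sup[OF assms(1,2)] by blast
  define z :: "real ^ 'n" where "z = (\<chi> i. if 0 \<le> w $ i then v $ i else 0)"
  have "z \<in> K"
  proof -
    have "0 \<le> z \<and> z \<le> v"
      using assms(4)[OF v] by (auto simp: less_eq_vec_def z_def)
    then show ?thesis
      using assms(3) v unfolding downward_closed_def by blast
  qed
  moreover have "?w \<bullet> v = w \<bullet> z"
    unfolding inner_vec_def by (intro sum.cong) (auto simp: z_def)
  ultimately show ?thesis using max by auto
qed

lemma exp_expectation_le:
  fixes X :: "'e \<Rightarrow> real"
  assumes "finite F" and "set_pmf \<nu> \<subseteq> F"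
  shows "exp (- measure_pmf.expectation \<nu> X) \<le> measure_pmf.expectation \<nu> (\<lambda>e. exp (- X e))"
proof -
  have fin: "finite (set_pmf \<nu>)" using assms finite_subset by blast
  have "exp (\<Sum>e\<in>set_pmf \<nu>. pmf \<nu> e *\<^sub>R (- X e)) \<le> (\<Sum>e\<in>set_pmf \<nu>. pmf \<nu> e * exp (- X e))"
    using fin set_pmf_not_empty[of \<nu>]
    by (intro convex_on_sum[OF _ _ exp_convex]) (auto simp: sum_pmf_eq_1)
  then show ?thesis by (simp add: expectation_finite[OF fin] sum_negf)
qed

theorem theorem4p1:
  fixes T :: "'t set"
    and A :: "'t \<Rightarrow> 'n::{finite,linorder} set"
    and K :: "'t \<Rightarrow> (real ^ 'n::{finite,linorder}) set"
    and m :: int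
    and u p :: real
  assumes "finite T" and "card T \<ge> 2"
    and "p = ln (real (card T))"
    and "\<And>t. t \<in> T \<Longrightarrow> int (card (A t)) \<le> m"
    and "\<And>t. t \<in> T \<Longrightarrow> K t \<noteq> {} \<and> compact (K t) \<and> convex (K t) \<and> downward_closed (K t)"
    and "\<And>t v. t \<in> T \<Longrightarrow> v \<in> K t \<Longrightarrow> 0 \<le> v"
    and "\<And>t v i. t \<in> T \<Longrightarrow> v \<in> K t \<Longrightarrow> i \<notin> A t \<Longrightarrow> v $ i = 0"
    and "u > 0"
    and "\<And>s t. s \<in> T \<Longrightarrow> t \<in> T \<Longrightarrow> s \<noteq> t \<Longrightarrow>
      max (support_fun (K t) (indvec (A t - A s))) (support_fun (K s) (indvec (A s - A t))) \<ge> u"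
  shows "\<exists>\<nu> :: ('t \<Rightarrow> 'n set) pmf. set_pmf \<nu> \<subseteq> encoders T A \<and>
    (let a = (\<lambda>t. (u / (2 * p)) *\<^sub>R measure_pmf.expectation \<nu> (\<lambda>E. tau T E t)) in
      (\<forall>t\<in>T. a t \<in> K t) \<and>
      (\<forall>s\<in>T. (\<Sum>t\<in>T. exp (- (2 * p / u) * mass (a t) (A t - A s))) \<le> (of_int m + 1) * 4 powi m))"
proof -
  have p: "p > 0" using assms(2,3) by simp
  let ?c = "u / (2 * p)"
  have fin: "finite (encoders T A)"
    unfolding encoders_def
    by (rule finite_subset[of _ "\<Pi>\<^sub>E t\<in>T. Pow (A t)"]) (auto intro: finite_PiE assms(1))
  have K: "K t \<noteq> {} \<and> compact (K t)" if "t \<in> T" for t using assms(5)[OF that] by blast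
  \<comment> \<open>The separation hypothesis makes \<open>A\<close> itself an embedding of \<open>T\<close> into the finite type
    \<open>'n set\<close>, as \<open>expectation_in_product\<close> requires.\<close>
  have injA: "inj_on A T"
  proof (rule inj_onI, rule ccontr)
    fix s t assume st: "s \<in> T" "t \<in> T" "A s = A t" "s \<noteq> t"
    have "support_fun (K r) (indvec {}) = 0" if "r \<in> T" for r
      using K[OF that] by (simp add: support_fun_def indvec_def inner_vec_def)
    then show False using assms(9)[OF st(1,2,4)] st assms(8) by simp
  qed
  have ineq: "\<exists>E\<in>encoders T A. \<exists>z. (\<forall>t\<in>T. z t \<in> K t) \<and>
      (\<Sum>t\<in>T. w t \<bullet> (?c *\<^sub>R tau T E t)) \<le> (\<Sum>t\<in>T. w t \<bullet> z t)"
    for w :: "'t \<Rightarrow> real ^ 'n::{finite,linorder}"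
  proof -
    let ?w = "\<lambda>t. (\<chi> i. max (w t $ i) 0) :: real ^ 'n::{finite,linorder}"
    have "\<exists>z\<in>K t. \<forall>v\<in>K t. ?w t \<bullet> v \<le> w t \<bullet> z" if "t \<in> T" for t
      using assms(5,6)[OF that] by (intro positive_part_attained) auto
    then have "\<forall>t\<in>T. \<exists>z. z \<in> K t \<and> (\<forall>v\<in>K t. ?w t \<bullet> v \<le> w t \<bullet> z)" by (simp add: Bex_def)
    from bchoice[OF this] obtain z where
      zM: "\<forall>t\<in>T. z t \<in> K t \<and> (\<forall>v\<in>K t. ?w t \<bullet> v \<le> w t \<bullet> z t)" ..
    have z: "z t \<in> K t" if "t \<in> T" for t using zM that by simp
    have M: "?w t \<bullet> v \<le> w t \<bullet> z t" if "t \<in> T" "v \<in> K t" for t v using zM that by simp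
    have w0: "0 \<le> ?w t" for t by (simp add: less_eq_vec_def)
    have "\<exists>E\<in>encoders T A. \<forall>t\<in>T. ?w t \<bullet> tau T E t \<le> w t \<bullet> z t / u * ln (real (card T))"
      by (rule adapted_encoder[where K = K, OF assms(1) K assms(6) assms(8,9) w0 M])
    then obtain E where E: "E \<in> encoders T A"
      and le: "\<And>t. t \<in> T \<Longrightarrow> ?w t \<bullet> tau T E t \<le> w t \<bullet> z t / u * p"
      unfolding assms(3) by (elim bexE) simp
    have "w t \<bullet> (?c *\<^sub>R tau T E t) \<le> w t \<bullet> z t" if t: "t \<in> T" for t
    proof -
      have "w t \<bullet> tau T E t \<le> ?w t \<bullet> tau T E t"
        unfolding inner_vec_def
        using tau_nonneg[OF assms(1) t] by (auto intro!: sum_mono mult_right_mono)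
      also have "\<dots> \<le> w t \<bullet> z t / u * p" using t by (rule le)
      finally have "?c * (w t \<bullet> tau T E t) \<le> ?c * (w t \<bullet> z t / u * p)"
        using p assms(8) by (intro mult_left_mono) auto
      \<comment> \<open>The encoder only needs the factor \<open>u / p\<close>; the \<open>2\<close> is slack, as \<open>w t \<bullet> z t\<close> is nonnegative.\<close>
      also have "\<dots> = w t \<bullet> z t / 2" using p assms(8) by simp
      also have "\<dots> \<le> w t \<bullet> z t"
      proof -
        have "0 \<le> ?w t \<bullet> z t"
          using w0[of t] assms(6)[OF t z[OF t]]
          by (auto simp: inner_vec_def less_eq_vec_def intro!: sum_nonneg)
        then show ?thesis using M[OF t z[OF t]] by simp
      qed
      finally show ?thesis by simp
    qed
    then have "(\<Sum>t\<in>T. w t \<bullet> (?c *\<^sub>R tau T E t)) \<le> (\<Sum>t\<in>T. w t \<bullet> z t)"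
      by (rule sum_mono)
    then show ?thesis using E z by blast
  qed
  have "closed (K t) \<and> convex (K t)" if "t \<in> T" for t
    using assms(5)[OF that] by (simp add: compact_imp_closed)
  from expectation_in_product[OF fin injA this ineq]
  obtain \<nu> where \<nu>: "set_pmf \<nu> \<subseteq> encoders T A"
    and in_K: "\<And>t. t \<in> T \<Longrightarrow> measure_pmf.expectation \<nu> (\<lambda>E. ?c *\<^sub>R tau T E t) \<in> K t"
    by blast
  define a where "a t = ?c *\<^sub>R measure_pmf.expectation \<nu> (\<lambda>E. tau T E t)" for t
  have a_in: "a t \<in> K t" if "t \<in> T" for t
    using in_K[OF that] by (simp add: a_def)
  have bound: "(\<Sum>t\<in>T. exp (- (2 * p / u) * mass (a t) (A t - A s))) \<le> (of_int m + 1) * 4 powi m"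
    if s: "s \<in> T" for s
  proof -
    have m: "real_of_int m = real (nat m)" "(4::real) powi m = 4 ^ nat m"
      using assms(4)[OF s] by (simp_all add: power_int_def)
    have "(\<Sum>t\<in>T. exp (- (2 * p / u) * mass (a t) (A t - A s))) =
        (\<Sum>t\<in>T. exp (- measure_pmf.expectation \<nu> (\<lambda>E. mass (tau T E t) (A t - A s))))"
    proof (intro sum.cong refl arg_cong[where f = exp])
      fix t
      have "mass (a t) D = ?c * measure_pmf.expectation \<nu> (\<lambda>E. mass (tau T E t) D)" for D
        by (simp add: a_def mass_def expectation_finite[OF fin \<nu>] sum_distrib_left
            sum.swap[of _ _ "encoders T A"])
      then show "- (2 * p / u) * mass (a t) (A t - A s) =
          - measure_pmf.expectation \<nu> (\<lambda>E. mass (tau T E t) (A t - A s))"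
        using p assms(8) by simp
    qed
    also have "\<dots> \<le> (\<Sum>t\<in>T. measure_pmf.expectation \<nu> (\<lambda>E. exp (- mass (tau T E t) (A t - A s))))"
      by (intro sum_mono exp_expectation_le[OF fin \<nu>])
    also have "\<dots> = (\<Sum>E\<in>encoders T A. pmf \<nu> E * (\<Sum>t\<in>T. exp (- mass (tau T E t) (A t - A s))))"
      by (simp add: expectation_finite[OF fin \<nu>] sum_distrib_left sum.swap[of _ _ T])
    also have "\<dots> \<le> (\<Sum>E\<in>encoders T A. pmf \<nu> E * ((real (nat m) + 1) * 4 ^ nat m))"
    proof (intro sum_mono mult_left_mono)
      have "card (A t) \<le> nat m" if "t \<in> T" for t using assms(4)[OF that] by simp
      then show "(\<Sum>t\<in>T. exp (- mass (tau T E t) (A t - A s))) \<le> (real (nat m) + 1) * 4 ^ nat m"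
        if "E \<in> encoders T A" for E
        using sum_exp_mass_tau_le[OF assms(1) that] s by blast
    qed simp
    also have "\<dots> = (of_int m + 1) * 4 powi m"
      using sum_pmf_eq_1[OF fin \<nu>] by (simp add: m flip: sum_distrib_right)
    finally show ?thesis .
  qed
  show ?thesis
    using \<nu> a_in bound by (intro exI[of _ \<nu>]) (simp add: Let_def a_def)
qed

end
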